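(* Let $\gamma>0$, let $\pi_\theta$ be the policy-induced probability distribution on the set of complete trajectories, and let $V(o)$ denote the cumulative information value of a trajectory $o$ (both as defined in the context). Consider the following variational objective over all probability distributions $\mu$ on the set of complete trajectories: $$\max_{\mu}\;\mathbb{E}_{o\sim\mu}\bigl[V(o)\bigr]-\frac{1}{\gamma}\,\mathbb{D}_{\mathrm{KL}}\bigl(\mu\,\|\,\pi_\theta\bigr).$$ Then the unique optimizer (maximizer) of this problem is the distribution $\mu_\theta(o)\propto\pi_\theta(o)\exp\bigl(\gamma V(o)\bigr)$, i.e. $$\mu_\theta(o)=\frac{\pi_\theta(o)\exp(\gamma V(o))}{\sum_{\tilde o}\pi_\theta(\tilde o)\exp(\gamma V(\tilde o))},$$ where the sum is over all complete trajectories $\tilde o$.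
   Context: Fix an integer $T\ge 1$ and a question $q$. There is a finite set of possible turns (a turn is one interaction step of the agent, a text of bounded length). A history node of depth $t$ is a sequence $h_t=(q,\tau_1,\dots,\tau_t)$ consisting of the question $q$ followed by $t$ turns, with root $h_0=q$. A policy $\pi_\theta$ assigns to every history node $h$ of depth less than $T$ a probability distribution $\pi_\theta(\cdot\mid h)$ on the set of turns. A complete trajectory is a path $o=(h_0\xrightarrow{\tau_1}h_1\xrightarrow{\tau_2}\cdots\xrightarrow{\tau_T}h_T)$, where $h_t$ is obtained from $h_{t-1}$ by appending $\tau_t$; the set of complete trajectories is thus finite. The policy-induced trajectory distribution is $\pi_\theta(o)=\prod_{t=1}^{T}\pi_\theta(\tau_t\mid h_{t-1})$. Given a real-valued function $\mathrm{val}$ on history nodes, the cumulative information value of a trajectory is $V(o)=\sum_{t=1}^{T-1}\mathrm{val}(h_t)$. The Kullback–Leibler divergence is $\mathbb{D}_{\mathrm{KL}}(\mu\,\|\,\pi)=\sum_{o}\mu(o)\log\frac{\mu(o)}{\pi(o)}$, with the usual conventions $0\log 0=0$ and $\mathbb{D}_{\mathrm{KL}}(\mu\,\|\,\pi)=+\infty$ if $\mu(o)>0=\pi(o)$ for some $o$. *)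

theory Defs
  imports "HOL-Probability.Probability"
begin

text \<open>
  A history node \<open>(q, [\<tau>\<^sub>1, \<dots>, \<tau>\<^sub>t])\<close> is a question with the turns taken so far.
  Turns form a finite type. Policies are total functions on nodes; at horizon
  \<open>T\<close> and question \<open>q\<close>, only their values at nodes \<open>(q, \<tau>s)\<close> with
  \<open>length \<tau>s < T\<close> enter the definitions below.
\<close>

type_synonym ('q, 'a) node = "'q \<times> 'a list"
type_synonym ('q, 'a) policy = "('q, 'a) node \<Rightarrow> 'a pmf"

text \<open>
  A complete trajectory \<open>h\<^sub>0 \<rightarrow> \<dots> \<rightarrow> h\<^sub>T\<close> from the fixed root \<open>h\<^sub>0 = (q, [])\<close> is determined
  by its list of turns \<open>\<omega>\<close>, and \<open>node_at q \<omega> t\<close> recovers \<open>h\<^sub>t\<close>. The turn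
  \<open>\<tau>\<^sub>t\<close> is \<open>\<omega> ! (t - 1)\<close>, as lists are indexed from 0.
\<close>

definition trajectories :: "nat \<Rightarrow> 'a list set" where
  "trajectories T = {\<omega>. length \<omega> = T}"

definition node_at :: "'q \<Rightarrow> 'a list \<Rightarrow> nat \<Rightarrow> ('q, 'a) node" where
  "node_at q \<omega> t = (q, take t \<omega>)"

definition trajectory_prob :: "('q, 'a) policy \<Rightarrow> 'q \<Rightarrow> nat \<Rightarrow> 'a list \<Rightarrow> real" where
  "trajectory_prob \<pi> q T \<omega> = (\<Prod>t = 1..T. pmf (\<pi> (node_at q \<omega> (t - 1))) (\<omega> ! (t - 1)))"

definition trajectory_pmf :: "('q, 'a) policy \<Rightarrow> 'q \<Rightarrow> nat \<Rightarrow> 'a list pmf" where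
  "trajectory_pmf \<pi> q T =
     embed_pmf (\<lambda>\<omega>. if \<omega> \<in> trajectories T then trajectory_prob \<pi> q T \<omega> else 0)"

definition cumulative_value :: "(('q, 'a) node \<Rightarrow> real) \<Rightarrow> 'q \<Rightarrow> nat \<Rightarrow> 'a list \<Rightarrow> real" where
  "cumulative_value val q T \<omega> = (\<Sum>t = 1..T - 1. val (node_at q \<omega> t))"

text \<open>
  The library constant \<open>KL_divergence\<close> is real-valued and does not take the value \<open>\<infinity>\<close>
  in the absence of absolute continuity, hence the following definition for
  distributions on a finite set \<open>S\<close>.
\<close>

definition kl_div :: "'b set \<Rightarrow> 'b pmf \<Rightarrow> 'b pmf \<Rightarrow> ereal" where
  "kl_div S \<mu> \<nu> =
     (if \<exists>x\<in>S. pmf \<mu> x > 0 \<and> pmf \<nu> x = 0 then \<infinity>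
      else ereal (\<Sum>x\<in>S. if pmf \<mu> x = 0 then 0 else pmf \<mu> x * ln (pmf \<mu> x / pmf \<nu> x)))"

definition variational_objective ::
  "('q, 'a) policy \<Rightarrow> (('q, 'a) node \<Rightarrow> real) \<Rightarrow> 'q \<Rightarrow> nat \<Rightarrow> real \<Rightarrow> 'a list pmf \<Rightarrow> ereal" where
  "variational_objective \<pi> val q T \<gamma> \<mu> =
     ereal (measure_pmf.expectation \<mu> (cumulative_value val q T))
       - ereal (1 / \<gamma>) * kl_div (trajectories T) \<mu> (trajectory_pmf \<pi> q T)"

lemma finite_trajectories [simp]: "finite (trajectories T :: 'a :: finite list set)"
  using finite_lists_length_eq[of "UNIV :: 'a set" T] by (simp add: trajectories_def)

lemma trajectory_prob_nonneg: "0 \<le> trajectory_prob \<pi> q T \<omega>"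
  by (simp add: trajectory_prob_def prod_nonneg)

lemma trajectory_prob_snoc:
  assumes "length \<omega> = T"
  shows "trajectory_prob \<pi> q (Suc T) (\<omega> @ [a]) = trajectory_prob \<pi> q T \<omega> * pmf (\<pi> (q, \<omega>)) a"
proof -
  have "(\<Prod>t = 1..T. pmf (\<pi> (node_at q (\<omega> @ [a]) (t - 1))) ((\<omega> @ [a]) ! (t - 1))) =
        (\<Prod>t = 1..T. pmf (\<pi> (node_at q \<omega> (t - 1))) (\<omega> ! (t - 1)))"
    using assms by (intro prod.cong) (auto simp: node_at_def nth_append)
  moreover have "(\<omega> @ [a]) ! T = a"
    using assms by (simp add: nth_append)
  ultimately show ?thesis
    using assms by (simp add: trajectory_prob_def node_at_def)
qed

lemma sum_trajectory_prob:
  fixes \<pi> :: "('q, 'a :: finite) policy"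
  shows "(\<Sum>\<omega>\<in>trajectories T. trajectory_prob \<pi> q T \<omega>) = 1"
proof (induction T)
  case 0
  show ?case by (simp add: trajectories_def trajectory_prob_def)
next
  case (Suc T)
  have img: "trajectories (Suc T) = (\<lambda>(\<omega>, a). \<omega> @ [a]) ` (trajectories T \<times> (UNIV :: 'a set))"
    by (auto simp: trajectories_def image_iff length_Suc_conv_rev)
  have inj: "inj_on (\<lambda>(\<omega>, a). \<omega> @ [a]) (trajectories T \<times> (UNIV :: 'a set))"
    by (auto simp: inj_on_def)
  have "(\<Sum>\<omega>\<in>trajectories (Suc T). trajectory_prob \<pi> q (Suc T) \<omega>) =
        (\<Sum>(\<omega>, a)\<in>trajectories T \<times> UNIV. trajectory_prob \<pi> q (Suc T) (\<omega> @ [a]))"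
    unfolding img by (subst sum.reindex[OF inj]) (simp add: case_prod_unfold)
  also have "\<dots> = (\<Sum>\<omega>\<in>trajectories T. \<Sum>a\<in>UNIV. trajectory_prob \<pi> q T \<omega> * pmf (\<pi> (q, \<omega>)) a)"
    by (subst sum.cartesian_product[symmetric])
       (auto simp: trajectories_def trajectory_prob_snoc intro!: sum.cong)
  also have "\<dots> = (\<Sum>\<omega>\<in>trajectories T. trajectory_prob \<pi> q T \<omega>)"
    by (simp add: sum_distrib_left[symmetric] sum_pmf_eq_1)
  finally show ?case using Suc by simp
qed

lemma pmf_trajectory_pmf:
  fixes \<pi> :: "('q, 'a :: finite) policy"
  shows "pmf (trajectory_pmf \<pi> q T) \<omega> =
    (if \<omega> \<in> trajectories T then trajectory_prob \<pi> q T \<omega> else 0)"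
  unfolding trajectory_pmf_def
proof (rule pmf_embed_pmf)
  let ?f = "\<lambda>\<omega>. if \<omega> \<in> trajectories T then trajectory_prob \<pi> q T \<omega> else 0"
  show "0 \<le> ?f \<omega>" for \<omega>
    by (simp add: trajectory_prob_nonneg)
  have "(\<integral>\<^sup>+\<omega>. ennreal (?f \<omega>) \<partial>count_space UNIV) =
        (\<Sum>\<omega>\<in>trajectories T. ennreal (trajectory_prob \<pi> q T \<omega>))"
    by (subst nn_integral_count_space'[where A = "trajectories T"]) auto
  also have "\<dots> = 1"
    by (simp add: sum_ennreal trajectory_prob_nonneg sum_trajectory_prob)
  finally show "(\<integral>\<^sup>+\<omega>. ennreal (?f \<omega>) \<partial>count_space UNIV) = 1" .
qed

end

theory Submission
  imports Defs
begin

text \<open>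
  Let \<open>Z\<close> be the normalising constant of the Gibbs distribution \<open>\<mu>\<^sub>\<theta>\<close>. Completing the logarithm
  turns the objective into \<open>(ln Z - KL(\<mu> \<parallel> \<mu>\<^sub>\<theta>)) / \<gamma>\<close> for every \<open>\<mu>\<close>, with both sides equal to
  \<open>-\<infinity>\<close> at the same \<open>\<mu>\<close> because \<open>\<mu>\<^sub>\<theta>\<close> and the reference distribution have the same support.
  By Gibbs' inequality, the divergence is nonnegative and vanishes only at \<open>\<mu> = \<mu>\<^sub>\<theta>\<close>.
\<close>

text \<open>Both parts come from \<open>ln u \<le> u - 1\<close> at \<open>u = b / a\<close>, where
  equality forces \<open>u = 1\<close>. The bound \<open>a - b\<close> is the useful one because it
  sums to 0 when \<open>a\<close> and \<open>b\<close> run over the masses of two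
  distributions.\<close>

lemma kl_term_ge:
  fixes a b :: real
  assumes "0 < a" "0 < b"
  shows "a - b \<le> a * ln (a / b)"
    and "a * ln (a / b) = a - b \<Longrightarrow> a = b"
proof -
  have ln: "a * ln (a / b) = - (a * ln (b / a))"
    using assms by (simp add: ln_div algebra_simps)
  have "a * ln (b / a) \<le> a * (b / a - 1)"
    using assms by (intro mult_left_mono ln_le_minus_one) auto
  then show "a - b \<le> a * ln (a / b)"
    using assms ln by (simp add: right_diff_distrib)
  assume "a * ln (a / b) = a - b"
  then have "a * ln (b / a) = a * (b / a - 1)"
    using assms ln by (simp add: right_diff_distrib)
  then have "ln (b / a) = b / a - 1"
    using assms by simp
  then have "b / a = 1"
    using assms by (intro ln_eq_minus_one) auto
  then show "a = b"
    using assms by simp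
qed

lemma kl_div_self: "kl_div S \<mu> \<mu> = 0"
  unfolding kl_div_def by (auto intro!: sum.neutral)

lemma
  assumes "finite S" "set_pmf \<mu> \<subseteq> S" "set_pmf \<nu> \<subseteq> S"
  shows kl_div_nonneg: "0 \<le> kl_div S \<mu> \<nu>"
    and kl_div_eq_0_iff: "kl_div S \<mu> \<nu> = 0 \<longleftrightarrow> \<mu> = \<nu>"
proof -
  have *: "0 \<le> kl_div S \<mu> \<nu> \<and> (kl_div S \<mu> \<nu> = 0 \<longrightarrow> \<mu> = \<nu>)"
  proof (cases "\<exists>x\<in>S. pmf \<mu> x > 0 \<and> pmf \<nu> x = 0")
    case True
    then show ?thesis by (simp add: kl_div_def)
  next
    case False
    define t where "t x = (if pmf \<mu> x = 0 then 0 else pmf \<mu> x * ln (pmf \<mu> x / pmf \<nu> x))" for x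
    \<comment> \<open>Since both masses total 1 on \<open>S\<close>, this correction leaves the sum
      unchanged, while each single term becomes nonnegative.\<close>
    define d where "d x = t x - (pmf \<mu> x - pmf \<nu> x)" for x
    have pos: "0 < pmf \<mu> x \<and> 0 < pmf \<nu> x" if "x \<in> S" "pmf \<mu> x \<noteq> 0" for x
      using False that by (metis pmf_nonneg order_le_less)
    have d_nonneg: "0 \<le> d x" if "x \<in> S" for x
      using pos[OF that] kl_term_ge(1)[of "pmf \<mu> x" "pmf \<nu> x"] by (auto simp: d_def t_def)
    \<comment> \<open>Where \<open>pmf \<mu> x = 0\<close>, \<open>d x\<close> is just
      \<open>pmf \<nu> x\<close>, so equality is forced there as well.\<close>
    have d_0: "pmf \<mu> x = pmf \<nu> x" if "x \<in> S" "d x = 0" for x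
      using pos[of x] kl_term_ge(2)[of "pmf \<mu> x" "pmf \<nu> x"] that
      by (auto simp: d_def t_def split: if_splits)
    have "(\<Sum>x\<in>S. d x) = (\<Sum>x\<in>S. t x)"
      using assms by (simp add: d_def sum_subtractf sum_pmf_eq_1)
    moreover have "kl_div S \<mu> \<nu> = ereal (\<Sum>x\<in>S. t x)"
      using False by (auto simp: kl_div_def t_def)
    ultimately have kl: "kl_div S \<mu> \<nu> = ereal (\<Sum>x\<in>S. d x)"
      by simp
    have "\<mu> = \<nu>" if "kl_div S \<mu> \<nu> = 0"
    proof (rule pmf_eqI)
      fix x
      have "\<forall>y\<in>S. d y = 0"
        using that kl d_nonneg assms(1) by (simp add: sum_nonneg_eq_0_iff)
      \<comment> \<open>Outside \<open>S\<close> both masses are 0 by the support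
        assumptions.\<close>
      then show "pmf \<mu> x = pmf \<nu> x"
        using d_0[of x] assms(2,3) by (metis pmf_eq_0_set_pmf subsetD)
    qed
    then show ?thesis
      using kl d_nonneg by (simp add: sum_nonneg)
  qed
  then show "0 \<le> kl_div S \<mu> \<nu>" by simp
  from * show "kl_div S \<mu> \<nu> = 0 \<longleftrightarrow> \<mu> = \<nu>" by (auto simp: kl_div_self)
qed

definition partition_sum :: "'b set \<Rightarrow> ('b \<Rightarrow> real) \<Rightarrow> 'b pmf \<Rightarrow> real" where
  "partition_sum S f \<nu> = (\<Sum>x\<in>S. pmf \<nu> x * exp (f x))"

text \<open>The weights need no cut-off at \<open>S\<close>: they vanish wherever
  \<open>\<nu>\<close> does, so they sum to 1 once \<open>\<nu>\<close> is supported in the finite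
  set \<open>S\<close>.\<close>

definition gibbs_pmf :: "'b set \<Rightarrow> ('b \<Rightarrow> real) \<Rightarrow> 'b pmf \<Rightarrow> 'b pmf" where
  "gibbs_pmf S f \<nu> = embed_pmf (\<lambda>x. pmf \<nu> x * exp (f x) / partition_sum S f \<nu>)"

lemma partition_sum_pos:
  assumes "finite S" "set_pmf \<nu> \<subseteq> S"
  shows "0 < partition_sum S f \<nu>"
proof -
  obtain x where "x \<in> set_pmf \<nu>"
    using set_pmf_not_empty by fastforce
  then show ?thesis
    unfolding partition_sum_def using assms
    by (intro sum_pos2[of S x]) (auto simp: pmf_positive)
qed

lemma pmf_gibbs_pmf:
  assumes "finite S" "set_pmf \<nu> \<subseteq> S"
  shows "pmf (gibbs_pmf S f \<nu>) x = pmf \<nu> x * exp (f x) / partition_sum S f \<nu>"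
  unfolding gibbs_pmf_def
proof (rule pmf_embed_pmf)
  let ?Z = "partition_sum S f \<nu>"
  have Z: "0 < ?Z"
    by (rule partition_sum_pos[OF assms])
  then show nonneg: "0 \<le> pmf \<nu> x * exp (f x) / ?Z" for x
    by simp
  have outside: "pmf \<nu> x = 0" if "x \<notin> S" for x
    using that assms(2) by (auto simp: pmf_eq_0_set_pmf)
  have "(\<integral>\<^sup>+x. ennreal (pmf \<nu> x * exp (f x) / ?Z) \<partial>count_space UNIV) =
        (\<Sum>x\<in>S. ennreal (pmf \<nu> x * exp (f x) / ?Z))"
    using assms(1) by (intro nn_integral_count_space') (auto simp: outside)
  also have "\<dots> = ennreal (\<Sum>x\<in>S. pmf \<nu> x * exp (f x) / ?Z)"
    by (rule sum_ennreal) (rule nonneg)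
  also have "(\<Sum>x\<in>S. pmf \<nu> x * exp (f x) / ?Z) = 1"
    using Z by (simp add: partition_sum_def sum_divide_distrib[symmetric])
  finally show "(\<integral>\<^sup>+x. ennreal (pmf \<nu> x * exp (f x) / ?Z) \<partial>count_space UNIV) = 1"
    by simp
qed

lemma set_pmf_gibbs_pmf:
  assumes "finite S" "set_pmf \<nu> \<subseteq> S"
  shows "set_pmf (gibbs_pmf S f \<nu>) = set_pmf \<nu>"
  using partition_sum_pos[OF assms, of f] by (auto simp: set_pmf_eq pmf_gibbs_pmf[OF assms])

text \<open>On the support of \<open>\<mu>\<close>,
  \<open>ln (pmf \<mu> x / pmf \<nu> x) - f x\<close> equals the log-ratio of \<open>\<mu>\<close>
  to the Gibbs distribution minus \<open>ln ?Z\<close>; average over \<open>\<mu>\<close>. The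
  factor \<gamma> is absorbed into \<open>f\<close> when the identity is applied.\<close>

lemma expectation_minus_kl_div:
  assumes S: "finite S" "set_pmf \<mu> \<subseteq> S" "set_pmf \<nu> \<subseteq> S"
  shows "ereal (measure_pmf.expectation \<mu> f) - kl_div S \<mu> \<nu> =
    ereal (ln (partition_sum S f \<nu>)) - kl_div S \<mu> (gibbs_pmf S f \<nu>)"
proof -
  let ?Z = "partition_sum S f \<nu>" and ?g = "gibbs_pmf S f \<nu>"
  have Z: "0 < ?Z"
    by (rule partition_sum_pos[OF S(1,3)])
  have g: "pmf ?g x = pmf \<nu> x * exp (f x) / ?Z" for x
    by (rule pmf_gibbs_pmf[OF S(1,3)])
  have g_0: "pmf ?g x = 0 \<longleftrightarrow> pmf \<nu> x = 0" for x
    using Z by (simp add: g)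
  show ?thesis
  proof (cases "\<exists>x\<in>S. pmf \<mu> x > 0 \<and> pmf \<nu> x = 0")
    case True
    then show ?thesis by (simp add: kl_div_def g_0)
  next
    case False
    let ?t = "\<lambda>\<rho> x. if pmf \<mu> x = 0 then 0 else pmf \<mu> x * ln (pmf \<mu> x / pmf \<rho> x)"
    have "pmf \<mu> x * f x - ?t \<nu> x = pmf \<mu> x * ln ?Z - ?t ?g x" if "x \<in> S" for x
    proof (cases "pmf \<mu> x = 0")
      case nz: False
      then have "0 < pmf \<mu> x" "0 < pmf \<nu> x"
        using False that by (metis pmf_nonneg order_le_less)+
      then show ?thesis
        using Z nz by (simp add: g ln_div ln_mult algebra_simps)
    qed simp
    then have "(\<Sum>x\<in>S. pmf \<mu> x * f x) - (\<Sum>x\<in>S. ?t \<nu> x) =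
        (\<Sum>x\<in>S. pmf \<mu> x * ln ?Z) - (\<Sum>x\<in>S. ?t ?g x)"
      by (simp only: sum_subtractf[symmetric] cong: sum.cong)
    moreover have "(\<Sum>x\<in>S. pmf \<mu> x * ln ?Z) = ln ?Z"
      using S by (simp add: sum_distrib_right[symmetric] sum_pmf_eq_1)
    moreover have "measure_pmf.expectation \<mu> f = (\<Sum>x\<in>S. pmf \<mu> x * f x)"
      using S by (subst integral_measure_pmf_real[of S]) (auto simp: mult.commute)
    moreover have "kl_div S \<mu> \<nu> = ereal (\<Sum>x\<in>S. ?t \<nu> x)"
      using False by (simp add: kl_div_def)
    moreover have "kl_div S \<mu> ?g = ereal (\<Sum>x\<in>S. ?t ?g x)"
      using False by (simp add: kl_div_def g_0)
    ultimately show ?thesis by simp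
  qed
qed

text \<open>\<open>is_arg_max\<close> only asks that no admissible point have a strictly larger
  value, so strict domination by \<open>g\<close> both makes \<open>g\<close> a maximizer and rules
  out every rival.\<close>

lemma is_arg_max_unique_iff:
  fixes F :: "'b \<Rightarrow> 'c :: order"
  assumes "P g" "\<And>x. P x \<Longrightarrow> x \<noteq> g \<Longrightarrow> F x < F g"
  shows "is_arg_max F P x \<longleftrightarrow> x = g"
  using assms unfolding is_arg_max_def by (metis order_less_asym)

lemma is_arg_max_expectation_minus_kl_div:
  assumes S: "finite S" "set_pmf \<nu> \<subseteq> S" and "\<gamma> > 0"
  shows "is_arg_max (\<lambda>\<mu>. ereal (measure_pmf.expectation \<mu> f) - ereal (1 / \<gamma>) * kl_div S \<mu> \<nu>)
      (\<lambda>\<mu>. set_pmf \<mu> \<subseteq> S) \<mu> \<longleftrightarrow> \<mu> = gibbs_pmf S (\<lambda>x. \<gamma> * f x) \<nu>"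
proof (rule is_arg_max_unique_iff)
  let ?g = "gibbs_pmf S (\<lambda>x. \<gamma> * f x) \<nu>" and ?Z = "partition_sum S (\<lambda>x. \<gamma> * f x) \<nu>"
  let ?J = "\<lambda>\<mu>. ereal (measure_pmf.expectation \<mu> f) - ereal (1 / \<gamma>) * kl_div S \<mu> \<nu>"
  show g: "set_pmf ?g \<subseteq> S"
    using S by (simp add: set_pmf_gibbs_pmf)
  \<comment> \<open>Distributing over a difference is delicate in \<open>ereal\<close>; as \<gamma>
    is positive and finite, it also holds for infinite \<open>k\<close>.\<close>
  have scale: "ereal (\<gamma> * e) - k = ereal \<gamma> * (ereal e - ereal (1 / \<gamma>) * k)" for e k
    using \<open>\<gamma> > 0\<close> by (cases k) (auto simp: field_simps)
  have J: "ereal \<gamma> * ?J \<mu> = ereal (ln ?Z) - kl_div S \<mu> ?g" if "set_pmf \<mu> \<subseteq> S" for \<mu>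
    using expectation_minus_kl_div[OF S(1) that S(2), of "\<lambda>x. \<gamma> * f x"]
    by (simp add: scale)
  fix \<mu> assume \<mu>: "set_pmf \<mu> \<subseteq> S" "\<mu> \<noteq> ?g"
  then have "0 < kl_div S \<mu> ?g"
    using kl_div_nonneg[OF S(1) \<mu>(1) g] kl_div_eq_0_iff[OF S(1) \<mu>(1) g] by (simp add: order_less_le)
  \<comment> \<open>At \<open>?g\<close> the value is the finite number \<open>ln ?Z\<close>, so a
    positive divergence, even an infinite one, gives a strictly smaller value.\<close>
  then have "ereal \<gamma> * ?J \<mu> < ereal \<gamma> * ?J ?g"
    unfolding J[OF \<mu>(1)] J[OF g] by (cases "kl_div S \<mu> ?g") (auto simp: kl_div_self)
  then show "?J \<mu> < ?J ?g"
    \<comment> \<open>The factor cancels by contraposition: \<open>?J ?g \<le> ?J \<mu>\<close>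
      would survive multiplication by \<gamma>.\<close>
    using \<open>\<gamma> > 0\<close> by (metis ereal_mult_left_mono ereal_less_eq(5) less_imp_le not_le)
qed

theorem theorem2:
  fixes \<pi> :: "('q, 'a :: finite) policy"
    and val :: "('q, 'a) node \<Rightarrow> real"
    and q :: 'q and T :: nat and \<gamma> :: real
  assumes "T \<ge> 1" and "\<gamma> > 0"
  shows "\<exists>\<mu>\<^sub>\<theta> :: 'a list pmf.
    set_pmf \<mu>\<^sub>\<theta> \<subseteq> trajectories T \<and>
    (\<forall>\<omega>\<in>trajectories T. pmf \<mu>\<^sub>\<theta> \<omega> =
       pmf (trajectory_pmf \<pi> q T) \<omega> * exp (\<gamma> * cumulative_value val q T \<omega>) /
       (\<Sum>\<omega>'\<in>trajectories T.
          pmf (trajectory_pmf \<pi> q T) \<omega>' * exp (\<gamma> * cumulative_value val q T \<omega>'))) \<and>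
    (\<forall>\<mu>. is_arg_max (variational_objective \<pi> val q T \<gamma>)
           (\<lambda>\<mu>. set_pmf \<mu> \<subseteq> trajectories T) \<mu> \<longleftrightarrow> \<mu> = \<mu>\<^sub>\<theta>)"
proof (intro exI conjI ballI allI)
  let ?p = "trajectory_pmf \<pi> q T" and ?V = "cumulative_value val q T"
  \<comment> \<open>The witness carries \<gamma> in the exponent, matching the weight
    \<open>1 / \<gamma>\<close> on the divergence.\<close>
  let ?g = "gibbs_pmf (trajectories T) (\<lambda>\<omega>. \<gamma> * ?V \<omega>) ?p"
  have p: "set_pmf ?p \<subseteq> trajectories T"
    by (auto simp: set_pmf_eq pmf_trajectory_pmf)
  then show "set_pmf ?g \<subseteq> trajectories T"
    by (simp add: set_pmf_gibbs_pmf)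
  show "pmf ?g \<omega> = pmf ?p \<omega> * exp (\<gamma> * ?V \<omega>) /
      (\<Sum>\<omega>'\<in>trajectories T. pmf ?p \<omega>' * exp (\<gamma> * ?V \<omega>'))" for \<omega>
    using pmf_gibbs_pmf[OF finite_trajectories p] by (simp add: partition_sum_def)
  show "is_arg_max (variational_objective \<pi> val q T \<gamma>)
      (\<lambda>\<mu>. set_pmf \<mu> \<subseteq> trajectories T) \<mu> \<longleftrightarrow> \<mu> = ?g" for \<mu>
    using is_arg_max_expectation_minus_kl_div[OF finite_trajectories p \<open>\<gamma> > 0\<close>]
    unfolding variational_objective_def[abs_def] .
qed

end
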